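(* Let $G=(V,E)$ be a finite connected weighted graph with $|V|\ge 2$ and symmetric weights $w_{uv}>0$ if $\{u,v\}\in E$ and $w_{uv}=0$ otherwise. Let $L$ be the combinatorial or the normalized Laplacian of $G$, let $W$ be a real diagonal matrix indexed by $V$, let $\lambda_0\le\lambda_1$ be the two lowest eigenvalues of $L+W$, and for $i=0,1$ let $\phi_i:V\to\mathbb{R}$ be the corresponding eigenfunctions, satisfying $$[\lambda_i-W_u]\,q_u\,\phi_i(u)=\sum_{v\sim u}w_{uv}[\phi_i(u)-\phi_i(v)]\qquad(u\in V).$$ Let $\gamma=\lambda_1-\lambda_0$, let $h$ be the weighted Cheeger constant corresponding to $\phi_0$, and let $S=\{u\in V:\phi_1(u)\ge 0\}$, where the sign of $\phi_1$ is such that $\sum_{u\in S}q_u\phi_0^2(u)\le\sum_{u\notin S}q_u\phi_0^2(u)$. Then $$\gamma\ \ge\ \sqrt{h^2+Q^2}-Q,\qquad\text{where}\qquad Q=\frac{\sum_{u\in S}d_u\phi_1^2(u)}{\sum_{u\in S}q_u\phi_1^2(u)}.$$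
   Context: The degree of $u$ is $d_u=\sum_v w_{uv}$. The combinatorial Laplacian has entries $L(u,u)=d_u$, $L(u,v)=-w_{uv}$ ($u\ne v$); the normalized Laplacian has entries $1$ on the diagonal and $-w_{uv}/\sqrt{d_ud_v}$ off the diagonal. $q_u=1$ in the combinatorial case and $q_u=d_u$ in the normalized case; in the latter case $\phi_i$ is $\mathrm{diag}(d_u)^{-1/2}$ times the corresponding eigenvector of the matrix $L+W$. The ground-state is taken with $\phi_0\ge0$; $\phi_1\not\equiv0$ is orthogonal to $\phi_0$ in the sense $\sum_u q_u\phi_0(u)\phi_1(u)=0$. $v\sim u$ means $\{u,v\}\in E$. For a nonempty proper $T\subset V$ with complement $\overline T$, let $|\partial T|=\sum_{u\in T,v\in\overline T}w_{uv}\phi_0(u)\phi_0(v)$ and $\mathrm{vol}(T)=\sum_{u\in T}q_u\phi_0^2(u)$. The weighted Cheeger constant is $h=\min_{\emptyset\neq T\subsetneq V}|\partial T|/\min\{\mathrm{vol}(T),\mathrm{vol}(\overline T)\}$. *)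

theory Defs
  imports "HOL-Analysis.Analysis" "HOL-Computational_Algebra.Polynomial"
begin

text \<open>
  The vertex set is the universe of a finite type; edges are two-element sets of vertices.
\<close>

definition weighted_graph :: "'v::finite set set \<Rightarrow> ('v \<Rightarrow> 'v \<Rightarrow> real) \<Rightarrow> bool" where
  "weighted_graph E w \<longleftrightarrow>
     (\<forall>e\<in>E. card e = 2) \<and>
     (\<forall>u v. w u v = w v u) \<and>
     (\<forall>u v. {u, v} \<in> E \<longrightarrow> w u v > 0) \<and>
     (\<forall>u v. {u, v} \<notin> E \<longrightarrow> w u v = 0)"

definition connected_graph :: "'v set set \<Rightarrow> bool" where
  "connected_graph E \<longleftrightarrow> (\<forall>u v. (u, v) \<in> {(x, y). {x, y} \<in> E}\<^sup>*)"

definition degree_of :: "('v::finite \<Rightarrow> 'v \<Rightarrow> real) \<Rightarrow> 'v \<Rightarrow> real" where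
  "degree_of w u = (\<Sum>v\<in>UNIV. w u v)"

datatype laplacian_kind = Combinatorial | Normalized

fun laplacian :: "laplacian_kind \<Rightarrow> ('v::finite \<Rightarrow> 'v \<Rightarrow> real) \<Rightarrow> real^'v^'v" where
  "laplacian Combinatorial w =
     (\<chi> u v. if u = v then degree_of w u else - w u v)"
| "laplacian Normalized w =
     (\<chi> u v. if u = v then 1 else - w u v / sqrt (degree_of w u * degree_of w v))"

fun vertex_weight :: "laplacian_kind \<Rightarrow> ('v::finite \<Rightarrow> 'v \<Rightarrow> real) \<Rightarrow> 'v \<Rightarrow> real" where
  "vertex_weight Combinatorial w u = 1"
| "vertex_weight Normalized w u = degree_of w u"

definition diagonal_matrix :: "real^'v^'v \<Rightarrow> bool" where
  "diagonal_matrix W \<longleftrightarrow> (\<forall>u v. u \<noteq> v \<longrightarrow> W $ u $ v = 0)"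

definition charpoly :: "real^'n^'n \<Rightarrow> real poly" where
  "charpoly A = det (mat [:0, 1:] - (\<chi> i j. [:A $ i $ j:]))"

text \<open>
  The real roots of the characteristic polynomial in increasing order, each repeated according
  to its multiplicity. For a symmetric matrix these are all of its eigenvalues.
\<close>

definition eigenvalues :: "real^'n^'n \<Rightarrow> real list" where
  "eigenvalues A = sorted_list_of_multiset (proots (charpoly A))"

text \<open>
  An eigenfunction is an eigenvector of \<open>L + W\<close> (\<open>L\<close> the Laplacian) in the combinatorial case,
  and the diagonal matrix with entries \<open>1 / sqrt d\<^sub>u\<close> applied to an eigenvector in the normalized
  case. As the vertex weight is \<open>1\<close> and \<open>d\<^sub>u\<close>, respectively, dividing by its square root covers both.
\<close>

definition eigenfunction ::
  "laplacian_kind \<Rightarrow> ('v::finite \<Rightarrow> 'v \<Rightarrow> real) \<Rightarrow> real^'v^'v \<Rightarrow> real \<Rightarrow> ('v \<Rightarrow> real) \<Rightarrow> bool" where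
  "eigenfunction k w W l \<phi> \<longleftrightarrow>
     (\<exists>\<psi>. \<psi> \<noteq> 0 \<and> (laplacian k w + W) *v \<psi> = l *\<^sub>R \<psi> \<and>
          (\<forall>u. \<phi> u = \<psi> $ u / sqrt (vertex_weight k w u)))"

definition eigen_equation ::
  "laplacian_kind \<Rightarrow> 'v::finite set set \<Rightarrow> ('v \<Rightarrow> 'v \<Rightarrow> real) \<Rightarrow> real^'v^'v \<Rightarrow> real \<Rightarrow> ('v \<Rightarrow> real) \<Rightarrow> bool"
  where
  "eigen_equation k E w W l \<phi> \<longleftrightarrow>
     (\<forall>u. (l - W $ u $ u) * vertex_weight k w u * \<phi> u =
          (\<Sum>v | {u, v} \<in> E. w u v * (\<phi> u - \<phi> v)))"

definition boundary_weight ::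
  "('v::finite \<Rightarrow> 'v \<Rightarrow> real) \<Rightarrow> ('v \<Rightarrow> real) \<Rightarrow> 'v set \<Rightarrow> real" where
  "boundary_weight w \<phi> T = (\<Sum>u\<in>T. \<Sum>v\<in>-T. w u v * \<phi> u * \<phi> v)"

definition vol ::
  "laplacian_kind \<Rightarrow> ('v::finite \<Rightarrow> 'v \<Rightarrow> real) \<Rightarrow> ('v \<Rightarrow> real) \<Rightarrow> 'v set \<Rightarrow> real" where
  "vol k w \<phi> T = (\<Sum>u\<in>T. vertex_weight k w u * (\<phi> u)\<^sup>2)"

definition cheeger ::
  "laplacian_kind \<Rightarrow> ('v::finite \<Rightarrow> 'v \<Rightarrow> real) \<Rightarrow> ('v \<Rightarrow> real) \<Rightarrow> real" where
  "cheeger k w \<phi> =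
     (MIN T\<in>{T. T \<noteq> {} \<and> T \<noteq> UNIV}.
        boundary_weight w \<phi> T / min (vol k w \<phi> T) (vol k w \<phi> (- T)))"

lemma degree_of_pos:
  fixes w :: "'v::finite \<Rightarrow> 'v \<Rightarrow> real"
  assumes "weighted_graph E w" "connected_graph E" "CARD('v) \<ge> 2"
  shows "degree_of w u > 0"
proof -
  have nn: "w x y \<ge> 0" for x y
    using assms(1) unfolding weighted_graph_def by (metis less_eq_real_def)
  have "\<exists>x. x \<noteq> u"
  proof (rule ccontr)
    assume "\<nexists>x. x \<noteq> u"
    then have "(UNIV :: 'v set) = {u}" by auto
    then have "CARD('v) = card {u}" by simp
    then show False using assms(3) by simp
  qed
  then obtain x where x: "x \<noteq> u" by blast
  have "(u, x) \<in> {(x, y). {x, y} \<in> E}\<^sup>*"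
    using assms(2) unfolding connected_graph_def by blast
  then obtain y where "{u, y} \<in> E"
    using x by (cases rule: converse_rtranclE) auto
  then have "w u y > 0" using assms(1) unfolding weighted_graph_def by blast
  moreover have "w u y \<le> degree_of w u"
    unfolding degree_of_def by (rule member_le_sum) (auto simp: nn)
  ultimately show ?thesis by linarith
qed

text \<open>
  Every eigenfunction satisfies the eigenvalue equation written in terms of edge differences.
\<close>

lemma eigenfunction_imp_eigen_equation:
  fixes w :: "'v::finite \<Rightarrow> 'v \<Rightarrow> real"
  assumes G: "weighted_graph E w" "connected_graph E" "CARD('v) \<ge> 2"
    and W: "diagonal_matrix W"
    and ef: "eigenfunction k w W l \<phi>"
  shows "eigen_equation k E w W l \<phi>"
  unfolding eigen_equation_def
proof
  fix u
  let ?d = "degree_of w" and ?q = "vertex_weight k w"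
  have dpos: "?d x > 0" for x using degree_of_pos[OF G] .
  then have qpos: "?q x > 0" for x by (cases k) auto
  obtain \<psi> where ev: "(laplacian k w + W) *v \<psi> = l *\<^sub>R \<psi>"
    and \<phi>: "\<And>x. \<phi> x = \<psi> $ x / sqrt (?q x)"
    using ef unfolding eigenfunction_def by blast
  have \<psi>: "\<psi> $ x = sqrt (?q x) * \<phi> x" for x
    using qpos[of x] by (simp add: \<phi>)
  have nl: "w u u = 0"
    using G(1) unfolding weighted_graph_def by force
  have off: "w u v = 0" if "{u, v} \<notin> E" for v
    using G(1) that unfolding weighted_graph_def by blast
  have entry: "sqrt (?q u) * laplacian k w $ u $ v * sqrt (?q v)
      = (if u = v then ?d u else 0) - w u v" for v
    using dpos[of u] dpos[of v] nl
    by (cases k) (auto simp: real_sqrt_mult)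
  have "l * \<psi> $ u = (\<Sum>v\<in>UNIV. (laplacian k w $ u $ v + W $ u $ v) * \<psi> $ v)"
    using arg_cong[OF ev, of "\<lambda>x. x $ u"] by (simp add: matrix_vector_mult_def)
  also have "\<dots> = (\<Sum>v\<in>UNIV. laplacian k w $ u $ v * \<psi> $ v)
      + (\<Sum>v\<in>UNIV. if v = u then W $ u $ u * \<psi> $ u else 0)"
    unfolding sum.distrib[symmetric]
    using W by (intro sum.cong) (auto simp: diagonal_matrix_def algebra_simps)
  finally have 1: "(l - W $ u $ u) * \<psi> $ u = (\<Sum>v\<in>UNIV. laplacian k w $ u $ v * \<psi> $ v)"
    by (simp add: algebra_simps)
  have "(l - W $ u $ u) * ?q u * \<phi> u = sqrt (?q u) * ((l - W $ u $ u) * \<psi> $ u)"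
    using qpos[of u] by (simp add: \<psi>)
  also have "\<dots> = (\<Sum>v\<in>UNIV. sqrt (?q u) * laplacian k w $ u $ v * sqrt (?q v) * \<phi> v)"
    unfolding 1 by (simp add: \<psi> sum_distrib_left mult.assoc)
  also have "\<dots> = (\<Sum>v\<in>UNIV. (if v = u then ?d u * \<phi> u else 0) - w u v * \<phi> v)"
    unfolding entry by (intro sum.cong) (auto simp: algebra_simps)
  also have "\<dots> = ?d u * \<phi> u - (\<Sum>v\<in>UNIV. w u v * \<phi> v)"
    by (simp add: sum_subtractf)
  also have "\<dots> = (\<Sum>v\<in>UNIV. w u v * (\<phi> u - \<phi> v))"
    by (simp add: degree_of_def sum_distrib_right sum_subtractf right_diff_distrib)
  also have "\<dots> = (\<Sum>v | {u, v} \<in> E. w u v * (\<phi> u - \<phi> v))"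
    by (intro sum.mono_neutral_right) (auto simp: off)
  finally show "(l - W $ u $ u) * ?q u * \<phi> u = (\<Sum>v | {u, v} \<in> E. w u v * (\<phi> u - \<phi> v))" .
qed

end

theory Submission
  imports Defs
begin

text \<open>
  Write \<open>\<phi>\<^sub>1 = f \<phi>\<^sub>0\<close>, which is possible because the ground state is strictly positive
  (\<open>ground_state_pos\<close>). Eliminating the potential between the two eigenvalue equations shows that
  \<open>f\<close> is an eigenfunction, with eigenvalue \<open>\<gamma>\<close>, of the Laplacian whose edge weights are
  \<open>c\<^sub>u\<^sub>v = w\<^sub>u\<^sub>v \<phi>\<^sub>0(u) \<phi>\<^sub>0(v)\<close> and whose vertex weights are \<open>q\<^sub>u \<phi>\<^sub>0(u)\<^sup>2\<close>. The number \<open>h\<close> is the ordinary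
  Cheeger constant of this reweighted graph, so Cheeger's argument applies to the positive part
  \<open>g\<close> of \<open>f\<close>, whose support lies in the smaller side \<open>S\<close>.

  Put \<open>N = \<Sum>\<^sub>S q \<phi>\<^sub>1\<^sup>2\<close>, \<open>A = \<Sum>\<^sub>S d \<phi>\<^sub>1\<^sup>2 = Q N\<close>, \<open>X = \<Sum>\<^sub>u\<^sub>v c\<^sub>u\<^sub>v g(u)\<^sup>2\<close>, and let \<open>D\<close> be the Dirichlet
  energy of \<open>g\<close>. Testing the equation of \<open>f\<close> against \<open>g\<close> gives \<open>D \<le> \<gamma> N\<close>
  (\<open>dirichlet_positive_part_le\<close>). Cutting \<open>g\<^sup>2\<close> into level sets (\<open>coarea_inequality\<close>) and then
  applying the Cauchy-Schwarz inequality (\<open>variation_square_le\<close>) give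
  \<open>h\<^sup>2 N\<^sup>2 \<le> D (2 X - D)\<close>.

  The potential enters \<open>X\<close> through the equation of the ground state, as
  \<open>X = A - \<Sum>\<^sub>S (\<lambda>\<^sub>0 - W) q \<phi>\<^sub>1\<^sup>2 = A + \<gamma> N - \<Sum>\<^sub>S (\<lambda>\<^sub>1 - W) q \<phi>\<^sub>1\<^sup>2\<close>. The last sum is nonnegative: it
  is the equation of \<open>\<phi>\<^sub>1\<close> tested against the positive part of \<open>\<phi>\<^sub>1\<close>, so it dominates a Dirichlet
  energy. Hence \<open>X \<le> A + \<gamma> N\<close>, and since \<open>D \<le> \<gamma> N \<le> A + \<gamma> N\<close>,
  \<open>h\<^sup>2 N\<^sup>2 \<le> D (2 (A + \<gamma> N) - D) \<le> \<gamma> N (2 A + \<gamma> N)\<close>, that is, \<open>h\<^sup>2 + Q\<^sup>2 \<le> (\<gamma> + Q)\<^sup>2\<close>.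
\<close>

section \<open>Dirichlet energies and positive parts\<close>

definition dirichlet :: "('v::finite \<Rightarrow> 'v \<Rightarrow> real) \<Rightarrow> ('v \<Rightarrow> real) \<Rightarrow> real" where
  "dirichlet c g = (\<Sum>u\<in>UNIV. \<Sum>v\<in>UNIV. c u v * (g u - g v)\<^sup>2) / 2"

lemma dirichlet_nonneg:
  assumes "\<And>u v. c u v \<ge> 0"
  shows "dirichlet c g \<ge> 0"
  unfolding dirichlet_def using assms by (auto intro!: sum_nonneg)

lemma sum_symmetric_swap:
  fixes c :: "'v::finite \<Rightarrow> 'v \<Rightarrow> real"
  assumes "\<And>u v. c u v = c v u"
  shows "(\<Sum>u\<in>UNIV. \<Sum>v\<in>UNIV. c u v * g v) = (\<Sum>u\<in>UNIV. \<Sum>v\<in>UNIV. c u v * g u)"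
proof -
  have "(\<Sum>u\<in>UNIV. \<Sum>v\<in>UNIV. c u v * g v) = (\<Sum>v\<in>UNIV. \<Sum>u\<in>UNIV. c u v * g v)"
    by (rule sum.swap)
  also have "\<dots> = (\<Sum>u\<in>UNIV. \<Sum>v\<in>UNIV. c u v * g u)"
    by (simp add: assms[of _ "v" for v])
  finally show ?thesis .
qed

lemma dirichlet_eq_sum:
  assumes sym: "\<And>u v. c u v = c v u"
  shows "dirichlet c g = (\<Sum>u\<in>UNIV. \<Sum>v\<in>UNIV. c u v * (g u * (g u - g v)))"
proof -
  have "(\<Sum>u\<in>UNIV. \<Sum>v\<in>UNIV. c u v * (g u - g v)\<^sup>2) =
      (\<Sum>u\<in>UNIV. \<Sum>v\<in>UNIV. 2 * (c u v * (g u * (g u - g v))) + c u v * (g v)\<^sup>2 - c u v * (g u)\<^sup>2)"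
    by (intro sum.cong refl) (simp add: power2_eq_square algebra_simps)
  also have "\<dots> = 2 * (\<Sum>u\<in>UNIV. \<Sum>v\<in>UNIV. c u v * (g u * (g u - g v)))"
    using sum_symmetric_swap[of c "\<lambda>v. (g v)\<^sup>2", OF sym]
    by (simp only: sum.distrib sum_subtractf sum_distrib_left[symmetric])
  finally show ?thesis by (simp add: dirichlet_def)
qed

text \<open>
  Tested against its own positive part, the Laplacian of \<open>f\<close> only gains from the vertices where
  \<open>f\<close> is negative: replacing \<open>f v\<close> by the larger \<open>max 0 (f v)\<close> shrinks every term.
\<close>

lemma dirichlet_positive_part_le:
  assumes sym: "\<And>u v. c u v = c v u" and nn: "\<And>u v. c u v \<ge> 0"
  shows "dirichlet c (\<lambda>u. max 0 (f u)) \<le>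
    (\<Sum>u\<in>UNIV. \<Sum>v\<in>UNIV. c u v * (max 0 (f u) * (f u - f v)))"
proof -
  have "max 0 (f u) * (max 0 (f u) - max 0 (f v)) \<le> max 0 (f u) * (f u - f v)" for u v
    by (cases "f u \<ge> 0") (auto intro!: mult_left_mono simp: max_def)
  then show ?thesis
    unfolding dirichlet_eq_sum[OF sym] by (intro sum_mono mult_left_mono[OF _ nn])
qed

section \<open>Cheeger's argument\<close>

lemma variation_indicator:
  fixes c :: "'v::finite \<Rightarrow> 'v \<Rightarrow> real"
  assumes sym: "\<And>u v. c u v = c v u"
  shows "(\<Sum>u\<in>UNIV. \<Sum>v\<in>UNIV. c u v * \<bar>indicator T u - indicator T v\<bar>) / 2 =
    (\<Sum>u\<in>T. \<Sum>v\<in>-T. c u v)"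
proof -
  let ?F = "\<lambda>u v. if u \<in> T \<and> v \<notin> T then c u v else 0"
  have F: "(\<Sum>u\<in>UNIV. \<Sum>v\<in>UNIV. ?F u v) = (\<Sum>u\<in>T. \<Sum>v\<in>-T. c u v)"
  proof -
    have "(\<Sum>v\<in>UNIV. ?F u v) = (if u \<in> T then \<Sum>v\<in>-T. c u v else 0)" for u
      by (auto simp: sum.If_cases intro!: sum.cong)
    then show ?thesis by (simp add: sum.If_cases)
  qed
  have "(\<Sum>u\<in>UNIV. \<Sum>v\<in>UNIV. c u v * \<bar>indicator T u - indicator T v\<bar>) =
      (\<Sum>u\<in>UNIV. \<Sum>v\<in>UNIV. ?F u v + ?F v u)"
    by (intro sum.cong refl) (auto simp: indicator_def sym)
  also have "\<dots> = (\<Sum>u\<in>UNIV. \<Sum>v\<in>UNIV. ?F u v) + (\<Sum>u\<in>UNIV. \<Sum>v\<in>UNIV. ?F v u)"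
    by (simp only: sum.distrib)
  also have "(\<Sum>u\<in>UNIV. \<Sum>v\<in>UNIV. ?F v u) = (\<Sum>u\<in>UNIV. \<Sum>v\<in>UNIV. ?F u v)"
    by (rule sum.swap)
  finally show ?thesis by (simp add: F)
qed

text \<open>
  A nonnegative function is a positive combination of indicators of its nested superlevel sets, and
  its total variation is the same combination of their cuts; hence an isoperimetric inequality
  for subsets of the support integrates to one for the function. The combination is built by
  induction on the support, peeling off the multiple of its indicator by the least positive value.
\<close>

lemma coarea_inequality:
  fixes c :: "'v::finite \<Rightarrow> 'v \<Rightarrow> real" and G m :: "'v \<Rightarrow> real"
  assumes sym: "\<And>u v. c u v = c v u"
    and iso: "\<And>T. T \<subseteq> R \<Longrightarrow> T \<noteq> {} \<Longrightarrow> h * sum m T \<le> (\<Sum>u\<in>T. \<Sum>v\<in>-T. c u v)"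
    and "\<And>u. G u \<ge> 0" and "{u. G u > 0} \<subseteq> R"
  shows "h * (\<Sum>u\<in>UNIV. m u * G u) \<le> (\<Sum>u\<in>UNIV. \<Sum>v\<in>UNIV. c u v * \<bar>G u - G v\<bar>) / 2"
  using assms(3,4)
proof (induction "card {u. G u > 0}" arbitrary: G rule: less_induct)
  case less
  define T where "T = {u. G u > 0}"
  show ?case
  proof (cases "T = {}")
    case True
    then have "G u = 0" for u
      using less.prems(1)[of u] by (auto simp: T_def less_le)
    then show ?thesis by simp
  next
    case False
    define a where "a = Min (G ` T)"
    have "a \<in> G ` T" unfolding a_def using False by (intro Min_in) auto
    then obtain x where x: "x \<in> T" "G x = a" by blast
    have a_pos: "a > 0" using x by (auto simp: T_def)
    have a_le: "a \<le> G u" if "u \<in> T" for u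
      unfolding a_def using that by (intro Min_le) auto
    have G0: "G u = 0" if "u \<notin> T" for u
      using that less.prems(1)[of u] by (auto simp: T_def)
    define G' where "G' u = G u - a * indicator T u" for u
    have G'_nn: "G' u \<ge> 0" for u
      using a_le[of u] less.prems(1)[of u] by (auto simp: G'_def indicator_def)
    have supp: "{u. G' u > 0} \<subset> T"
    proof
      show "{u. G' u > 0} \<subseteq> T"
        using G0 by (auto simp: G'_def indicator_def split: if_splits intro: ccontr)
      show "{u. G' u > 0} \<noteq> T"
        using x by (auto simp: G'_def indicator_def)
    qed
    then have IH: "h * (\<Sum>u\<in>UNIV. m u * G' u) \<le> (\<Sum>u\<in>UNIV. \<Sum>v\<in>UNIV. c u v * \<bar>G' u - G' v\<bar>) / 2"
      using G'_nn less.prems(2) by (intro less.hyps psubset_card_mono) (auto simp: T_def)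
    \<comment> \<open>Where the indicator changes, \<open>G'\<close> vanishes at the end outside \<open>T\<close>, so the two differences agree in sign.\<close>
    have split_abs: "\<bar>G u - G v\<bar> = \<bar>G' u - G' v\<bar> + a * \<bar>indicator T u - indicator T v\<bar>" for u v
      using a_pos a_le[of u] a_le[of v] G0[of u] G0[of v]
      by (auto simp: G'_def indicator_def)
    have "h * (\<Sum>u\<in>UNIV. m u * G u) = h * (\<Sum>u\<in>UNIV. m u * G' u + a * (m u * indicator T u))"
      by (simp add: G'_def algebra_simps)
    also have "\<dots> = h * (\<Sum>u\<in>UNIV. m u * G' u) + a * (h * sum m T)"
      by (simp add: sum.distrib sum_distrib_left[symmetric] sum.inter_restrict[symmetric]
          indicator_def if_distrib sum.If_cases algebra_simps)
    also have "\<dots> \<le> (\<Sum>u\<in>UNIV. \<Sum>v\<in>UNIV. c u v * \<bar>G' u - G' v\<bar>) / 2 + a * (\<Sum>u\<in>T. \<Sum>v\<in>-T. c u v)"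
      using IH iso[of T] False less.prems(2) a_pos by (intro add_mono mult_left_mono) (auto simp: T_def)
    also have "\<dots> = (\<Sum>u\<in>UNIV. \<Sum>v\<in>UNIV. c u v * \<bar>G u - G v\<bar>) / 2"
      unfolding variation_indicator[OF sym, symmetric] split_abs
      by (simp add: sum.distrib sum_distrib_left distrib_left add_divide_distrib mult.left_commute)
    finally show ?thesis .
  qed
qed

text \<open>
  Factor \<open>\<bar>g(u)\<^sup>2 - g(v)\<^sup>2\<bar> = \<bar>g(u) - g(v)\<bar> \<bar>g(u) + g(v)\<bar>\<close> and apply the Cauchy-Schwarz inequality. By
  the parallelogram law the second factor contributes exactly \<open>2 X - D\<close> rather than just the
  cruder \<open>2 X\<close>; keeping \<open>- D\<close> is what produces the square root in the final estimate.
\<close>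

lemma variation_square_le:
  assumes sym: "\<And>u v. c u v = c v u" and nn: "\<And>u v. c u v \<ge> 0"
  shows "((\<Sum>u\<in>UNIV. \<Sum>v\<in>UNIV. c u v * \<bar>(g u)\<^sup>2 - (g v)\<^sup>2\<bar>) / 2)\<^sup>2 \<le>
    dirichlet c g * (2 * (\<Sum>u\<in>UNIV. \<Sum>v\<in>UNIV. c u v * (g u)\<^sup>2) - dirichlet c g)"
proof -
  define a where "a = (\<lambda>(u, v). sqrt (c u v) * \<bar>g u - g v\<bar>)"
  define b where "b = (\<lambda>(u, v). sqrt (c u v) * \<bar>g u + g v\<bar>)"
  have ab: "a (u, v) * b (u, v) = c u v * \<bar>(g u)\<^sup>2 - (g v)\<^sup>2\<bar>" for u v
  proof -
    have "(g u)\<^sup>2 - (g v)\<^sup>2 = (g u - g v) * (g u + g v)"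
      by (simp add: power2_eq_square algebra_simps)
    moreover have "a (u, v) * b (u, v) = (sqrt (c u v))\<^sup>2 * (\<bar>g u - g v\<bar> * \<bar>g u + g v\<bar>)"
      by (simp add: a_def b_def power2_eq_square)
    ultimately show ?thesis using nn[of u v] by (simp add: abs_mult)
  qed
  have a2: "(a (u, v))\<^sup>2 = c u v * (g u - g v)\<^sup>2" for u v
    using nn[of u v] by (simp add: a_def power_mult_distrib)
  have b2: "(b (u, v))\<^sup>2 = 2 * (c u v * (g u)\<^sup>2) + 2 * (c u v * (g v)\<^sup>2) - c u v * (g u - g v)\<^sup>2" for u v
    using nn[of u v] by (simp add: b_def power_mult_distrib) (simp add: power2_eq_square algebra_simps)
  let ?X = "\<Sum>u\<in>UNIV. \<Sum>v\<in>UNIV. c u v * (g u)\<^sup>2"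
  have A: "(\<Sum>z\<in>UNIV \<times> UNIV. (a z)\<^sup>2) = 2 * dirichlet c g"
    unfolding sum.cartesian_product' a2 dirichlet_def by simp
  have B: "(\<Sum>z\<in>UNIV \<times> UNIV. (b z)\<^sup>2) = 2 * (2 * ?X - dirichlet c g)"
    unfolding sum.cartesian_product' b2
    using sum_symmetric_swap[of c "\<lambda>v. (g v)\<^sup>2", OF sym]
    by (simp only: sum.distrib sum_subtractf sum_distrib_left[symmetric]) (simp add: dirichlet_def)
  have "(\<Sum>u\<in>UNIV. \<Sum>v\<in>UNIV. c u v * \<bar>(g u)\<^sup>2 - (g v)\<^sup>2\<bar>) = (\<Sum>z\<in>UNIV \<times> UNIV. a z * b z)"
    by (simp only: sum.cartesian_product' ab)
  moreover have "(\<Sum>z\<in>UNIV \<times> UNIV. a z * b z)\<^sup>2 \<le> 2 * dirichlet c g * (2 * (2 * ?X - dirichlet c g))"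
    using Cauchy_Schwarz_ineq_sum[of a b "UNIV \<times> UNIV"] unfolding A B .
  ultimately show ?thesis by (simp add: power_divide algebra_simps)
qed

text \<open>
  On a set within the smaller side, the minimum in the definition of the Cheeger constant is the
  volume of the set itself.
\<close>

lemma cheeger_mult_vol_le:
  fixes w :: "'v::finite \<Rightarrow> 'v \<Rightarrow> real"
  assumes pos: "\<And>u. vertex_weight k w u * (\<phi> u)\<^sup>2 > 0"
    and half: "vol k w \<phi> S \<le> vol k w \<phi> (- S)" and T: "T \<subseteq> S" "T \<noteq> {}"
  shows "cheeger k w \<phi> * vol k w \<phi> T \<le> boundary_weight w \<phi> T"
proof -
  have vol_pos: "vol k w \<phi> R > 0" if "R \<noteq> {}" for R
    unfolding vol_def using that pos by (intro sum_pos) auto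
  have vol_mono: "vol k w \<phi> R \<le> vol k w \<phi> R'" if "R \<subseteq> R'" for R R'
    unfolding vol_def using that pos by (intro sum_mono2) (auto intro: less_imp_le)
  have "S \<noteq> UNIV"
  proof
    assume "S = UNIV"
    then have "vol k w \<phi> UNIV \<le> 0" using half by (simp add: vol_def)
    then show False using vol_pos[of UNIV] by simp
  qed
  then have "T \<noteq> UNIV" using T by auto
  have "vol k w \<phi> T \<le> vol k w \<phi> S" "vol k w \<phi> (- S) \<le> vol k w \<phi> (- T)"
    using T by (auto intro!: vol_mono)
  then have "min (vol k w \<phi> T) (vol k w \<phi> (- T)) = vol k w \<phi> T"
    using half by simp
  moreover have "cheeger k w \<phi> \<le> boundary_weight w \<phi> T / min (vol k w \<phi> T) (vol k w \<phi> (- T))"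
    unfolding cheeger_def using T \<open>T \<noteq> UNIV\<close> by (intro Min_le) auto
  ultimately show ?thesis
    using vol_pos[OF T(2)] by (simp add: pos_le_divide_eq)
qed

lemma cheeger_nonneg:
  fixes w :: "'v::finite \<Rightarrow> 'v \<Rightarrow> real"
  assumes card: "CARD('v) \<ge> 2" and "\<And>u v. w u v \<ge> 0" "\<And>u. vertex_weight k w u \<ge> 0"
    and "\<And>u. \<phi> u \<ge> 0"
  shows "cheeger k w \<phi> \<ge> 0"
proof -
  obtain x :: 'v where True by blast
  have "{x} \<noteq> UNIV"
  proof
    assume "{x} = UNIV"
    then have "CARD('v) = card {x}" by simp
    with card show False by simp
  qed
  then have ne: "{T. T \<noteq> {} \<and> T \<noteq> (UNIV :: 'v set)} \<noteq> {}" by blast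
  show ?thesis
    unfolding cheeger_def vol_def boundary_weight_def using ne assms(2-)
    by (subst Min_ge_iff) (auto intro!: divide_nonneg_nonneg sum_nonneg)
qed

section \<open>The eigenvalue equations\<close>

lemma eigen_equation_degree:
  fixes w :: "'v::finite \<Rightarrow> 'v \<Rightarrow> real"
  assumes "weighted_graph E w" and "eigen_equation k E w W l \<phi>"
  shows "(l - W $ u $ u) * vertex_weight k w u * \<phi> u =
    degree_of w u * \<phi> u - (\<Sum>v\<in>UNIV. w u v * \<phi> v)"
proof -
  have off: "w u v = 0" if "{u, v} \<notin> E" for v
    using assms(1) that unfolding weighted_graph_def by blast
  have "(l - W $ u $ u) * vertex_weight k w u * \<phi> u = (\<Sum>v | {u, v} \<in> E. w u v * (\<phi> u - \<phi> v))"
    using assms(2) by (simp add: eigen_equation_def)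
  also have "\<dots> = (\<Sum>v\<in>UNIV. w u v * (\<phi> u - \<phi> v))"
    using off by (intro sum.mono_neutral_left) auto
  also have "\<dots> = degree_of w u * \<phi> u - (\<Sum>v\<in>UNIV. w u v * \<phi> v)"
    by (simp add: degree_of_def sum_distrib_right sum_subtractf right_diff_distrib)
  finally show ?thesis .
qed

text \<open>
  A discrete strong maximum principle: at a zero of a nonnegative solution the equation reads
  \<open>\<Sum>\<^sub>v w\<^sub>u\<^sub>v \<phi>(v) = 0\<close>, so the zero set is closed under adjacency and by connectedness would be
  everything.
\<close>

lemma ground_state_pos:
  fixes w :: "'v::finite \<Rightarrow> 'v \<Rightarrow> real"
  assumes G: "weighted_graph E w" "connected_graph E"
    and eq: "eigen_equation k E w W l \<phi>" and nn: "\<And>u. \<phi> u \<ge> 0" and nz: "\<phi> y \<noteq> 0"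
  shows "\<phi> u > 0"
proof (rule ccontr)
  assume "\<not> \<phi> u > 0"
  then have zero: "\<phi> u = 0" using nn[of u] by simp
  have w_nn: "w x z \<ge> 0" for x z
    using G(1) unfolding weighted_graph_def by (metis less_eq_real_def)
  have step: "\<phi> z = 0" if "\<phi> x = 0" "{x, z} \<in> E" for x z
  proof -
    have "(\<Sum>v\<in>UNIV. w x v * \<phi> v) = 0"
      using eigen_equation_degree[OF G(1) eq, of x] that(1) by simp
    then have "w x z * \<phi> z = 0"
      using w_nn nn by (subst (asm) sum_nonneg_eq_0_iff) auto
    moreover have "w x z > 0" using G(1) that(2) by (auto simp: weighted_graph_def)
    ultimately show ?thesis by simp
  qed
  have "(u, y) \<in> {(x, y). {x, y} \<in> E}\<^sup>*"
    using G(2) by (simp add: connected_graph_def)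
  then have "\<phi> y = 0"
    by (induction rule: rtrancl_induct) (use zero step in auto)
  with nz show False ..
qed

lemma eigenfunction_nonzero:
  assumes "eigenfunction k w W l \<phi>" and pos: "\<And>u. vertex_weight k w u > 0"
  shows "\<exists>y. \<phi> y \<noteq> 0"
proof -
  obtain \<psi> where "\<psi> \<noteq> 0" and \<phi>: "\<And>u. \<phi> u = \<psi> $ u / sqrt (vertex_weight k w u)"
    using assms(1) by (auto simp: eigenfunction_def)
  then obtain y where "\<psi> $ y \<noteq> 0" by (auto simp: vec_eq_iff)
  then have "\<phi> y \<noteq> 0" using pos[of y] by (simp add: \<phi>)
  then show ?thesis ..
qed

section \<open>The spectral gap\<close>

theorem theorem3:
  fixes E :: "'v::finite set set"
    and w :: "'v \<Rightarrow> 'v \<Rightarrow> real"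
    and k :: laplacian_kind
    and W :: "real^'v^'v"
    and l0 l1 :: real
    and \<phi>0 \<phi>1 :: "'v \<Rightarrow> real"
    and S :: "'v set"
    and \<gamma> h Q :: real
  assumes "CARD('v) \<ge> 2"
    and "weighted_graph E w"
    and "connected_graph E"
    and "diagonal_matrix W"
    and "take 2 (eigenvalues (laplacian k w + W)) = [l0, l1]"
    and "eigenfunction k w W l0 \<phi>0"
    and "eigenfunction k w W l1 \<phi>1"
    and "eigen_equation k E w W l0 \<phi>0"
    and "eigen_equation k E w W l1 \<phi>1"
    and "\<forall>u. \<phi>0 u \<ge> 0"
    and "(\<Sum>u\<in>UNIV. vertex_weight k w u * \<phi>0 u * \<phi>1 u) = 0"
    and "\<gamma> = l1 - l0"
    and "h = cheeger k w \<phi>0"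
    and "S = {u. \<phi>1 u \<ge> 0}"
    and "(\<Sum>u\<in>S. vertex_weight k w u * (\<phi>0 u)\<^sup>2) \<le> (\<Sum>u\<in>-S. vertex_weight k w u * (\<phi>0 u)\<^sup>2)"
    and "Q = (\<Sum>u\<in>S. degree_of w u * (\<phi>1 u)\<^sup>2) / (\<Sum>u\<in>S. vertex_weight k w u * (\<phi>1 u)\<^sup>2)"
  shows "\<gamma> \<ge> sqrt (h\<^sup>2 + Q\<^sup>2) - Q"
proof -
  let ?q = "vertex_weight k w" and ?d = "degree_of w"
  define V where "V u = W $ u $ u" for u
  note G = assms(2,3,1)
  have w_sym: "w u v = w v u" for u v
    using assms(2) by (simp add: weighted_graph_def)
  have w_nn: "w u v \<ge> 0" for u v
    using assms(2) unfolding weighted_graph_def by (metis less_eq_real_def)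
  have d_pos: "?d u > 0" for u using degree_of_pos[OF G] .
  then have q_pos: "?q u > 0" for u by (cases k) auto
  have \<phi>0_pos: "\<phi>0 u > 0" for u
    using eigenfunction_nonzero[OF assms(6) q_pos] ground_state_pos[OF assms(2,3,8)] assms(10) by blast
  have eq0: "(l0 - V u) * ?q u * \<phi>0 u = ?d u * \<phi>0 u - (\<Sum>v\<in>UNIV. w u v * \<phi>0 v)" for u
    unfolding V_def by (rule eigen_equation_degree[OF assms(2,8)])
  have eq1: "(l1 - V u) * ?q u * \<phi>1 u = ?d u * \<phi>1 u - (\<Sum>v\<in>UNIV. w u v * \<phi>1 v)" for u
    unfolding V_def by (rule eigen_equation_degree[OF assms(2,9)])

  define p where "p u = max 0 (\<phi>1 u)" for u
  define f where "f u = \<phi>1 u / \<phi>0 u" for u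
  define g where "g u = max 0 (f u)" for u
  define c where "c u v = w u v * \<phi>0 u * \<phi>0 v" for u v
  define N where "N = (\<Sum>u\<in>UNIV. ?q u * (p u)\<^sup>2)"
  define A where "A = (\<Sum>u\<in>UNIV. ?d u * (p u)\<^sup>2)"
  define X where "X = (\<Sum>u\<in>UNIV. \<Sum>v\<in>UNIV. c u v * (g u)\<^sup>2)"
  define D where "D = dirichlet c g"
  have c_sym: "c u v = c v u" for u v by (simp add: c_def w_sym[of u v])
  have c_nn: "c u v \<ge> 0" for u v
    using w_nn \<phi>0_pos by (simp add: c_def less_imp_le)
  have \<phi>1_f: "\<phi>1 u = \<phi>0 u * f u" for u using \<phi>0_pos[of u] by (simp add: f_def)
  have p_g: "p u = \<phi>0 u * g u" for u
    using \<phi>0_pos[of u] by (auto simp: p_def g_def f_def max_def zero_le_divide_iff)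
  have p_sq: "(p u)\<^sup>2 = p u * \<phi>1 u" for u by (auto simp: p_def max_def power2_eq_square)

  have sum_S: "(\<Sum>u\<in>S. r u * (\<phi>1 u)\<^sup>2) = (\<Sum>u\<in>UNIV. r u * (p u)\<^sup>2)" for r :: "'v \<Rightarrow> real"
    by (rule sum.mono_neutral_cong_left) (auto simp: assms(14) p_def)
  have Q_eq: "Q = A / N" by (simp add: assms(16) sum_S A_def N_def)
  have A_nn: "A \<ge> 0" unfolding A_def using d_pos by (auto intro!: sum_nonneg simp: less_imp_le)

  \<comment> \<open>Orthogonality to the positive \<open>\<phi>0\<close> forces \<open>\<phi>1\<close> to change sign, so \<open>Q\<close> has a positive denominator.\<close>
  have N_pos: "N > 0"
  proof -
    have "\<exists>u. \<phi>1 u > 0"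
    proof (rule ccontr)
      assume "\<not> (\<exists>u. \<phi>1 u > 0)"
      then have le: "\<phi>1 u \<le> 0" for u by (meson not_le)
      have "(\<Sum>u\<in>UNIV. ?q u * \<phi>0 u * (- \<phi>1 u)) = 0"
        using assms(11) by (simp add: sum_negf)
      moreover have "?q u * \<phi>0 u * (- \<phi>1 u) \<ge> 0" for u
        using le[of u] q_pos[of u] \<phi>0_pos[of u] by (intro mult_nonneg_nonneg) auto
      ultimately have "?q u * \<phi>0 u * (- \<phi>1 u) = 0" for u
        by (subst (asm) sum_nonneg_eq_0_iff) auto
      then have "\<phi>1 u = 0" for u using q_pos[of u] \<phi>0_pos[of u] by (metis less_irrefl mult_eq_0_iff neg_equal_0_iff_equal)
      then show False using eigenfunction_nonzero[OF assms(7) q_pos] by simp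
    qed
    then obtain u where "\<phi>1 u > 0" ..
    then have "0 < ?q u * (p u)\<^sup>2" using q_pos[of u] by (simp add: p_def)
    also have "\<dots> \<le> N"
      unfolding N_def using q_pos by (intro member_le_sum) (auto simp: less_imp_le)
    finally show ?thesis .
  qed

  have D_le: "D \<le> \<gamma> * N"
  proof -
    have "D \<le> (\<Sum>u\<in>UNIV. \<Sum>v\<in>UNIV. c u v * (g u * (f u - f v)))"
      unfolding D_def g_def by (rule dirichlet_positive_part_le[OF c_sym c_nn])
    also have "\<dots> = (\<Sum>u\<in>UNIV. \<gamma> * (?q u * (p u)\<^sup>2))"
    proof (rule sum.cong[OF refl])
      fix u
      have "(\<Sum>v\<in>UNIV. c u v * (g u * (f u - f v))) =
          g u * (\<phi>1 u * (\<Sum>v\<in>UNIV. w u v * \<phi>0 v) - \<phi>0 u * (\<Sum>v\<in>UNIV. w u v * \<phi>1 v))"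
        unfolding sum_distrib_left sum_subtractf[symmetric]
        by (intro sum.cong refl) (simp add: c_def \<phi>1_f algebra_simps)
      \<comment> \<open>The degree and the potential cancel between the two equations.\<close>
      also have "\<phi>1 u * (\<Sum>v\<in>UNIV. w u v * \<phi>0 v) - \<phi>0 u * (\<Sum>v\<in>UNIV. w u v * \<phi>1 v) =
          \<gamma> * ?q u * \<phi>0 u * \<phi>1 u"
      proof -
        have e: "(\<Sum>v\<in>UNIV. w u v * \<phi>0 v) = ?d u * \<phi>0 u - (l0 - V u) * ?q u * \<phi>0 u"
          "(\<Sum>v\<in>UNIV. w u v * \<phi>1 v) = ?d u * \<phi>1 u - (l1 - V u) * ?q u * \<phi>1 u"
          using eq0[of u] eq1[of u] by linarith+
        show ?thesis unfolding e assms(12) by (simp add: algebra_simps)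
      qed
      finally show "(\<Sum>v\<in>UNIV. c u v * (g u * (f u - f v))) = \<gamma> * (?q u * (p u)\<^sup>2)"
        by (simp add: p_sq) (simp add: p_g)
    qed
    finally show ?thesis by (simp add: N_def sum_distrib_left)
  qed

  have X_le: "X \<le> A + \<gamma> * N"
  proof -
    define P where "P = (\<Sum>u\<in>UNIV. (l1 - V u) * ?q u * (p u)\<^sup>2)"
    have "0 \<le> dirichlet w p" by (rule dirichlet_nonneg[OF w_nn])
    also have "\<dots> \<le> (\<Sum>u\<in>UNIV. \<Sum>v\<in>UNIV. w u v * (p u * (\<phi>1 u - \<phi>1 v)))"
      unfolding p_def by (rule dirichlet_positive_part_le[OF w_sym w_nn])
    also have "\<dots> = P"
      unfolding P_def
    proof (rule sum.cong[OF refl])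
      fix u
      have "(\<Sum>v\<in>UNIV. w u v * (p u * (\<phi>1 u - \<phi>1 v))) =
          p u * (?d u * \<phi>1 u - (\<Sum>v\<in>UNIV. w u v * \<phi>1 v))"
        unfolding degree_of_def sum_distrib_right sum_subtractf[symmetric] sum_distrib_left
        by (intro sum.cong refl) (simp add: algebra_simps)
      then show "(\<Sum>v\<in>UNIV. w u v * (p u * (\<phi>1 u - \<phi>1 v))) = (l1 - V u) * ?q u * (p u)\<^sup>2"
        unfolding eq1[symmetric] p_sq by (simp add: mult_ac)
    qed
    finally have P_nn: "P \<ge> 0" .
    have "X = (\<Sum>u\<in>UNIV. ?d u * (p u)\<^sup>2 + \<gamma> * (?q u * (p u)\<^sup>2) - (l1 - V u) * ?q u * (p u)\<^sup>2)"
      unfolding X_def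
    proof (rule sum.cong[OF refl])
      fix u
      have "(\<Sum>v\<in>UNIV. c u v * (g u)\<^sup>2) = (g u)\<^sup>2 * \<phi>0 u * (\<Sum>v\<in>UNIV. w u v * \<phi>0 v)"
        by (simp add: c_def sum_distrib_left mult_ac)
      also have "(\<Sum>v\<in>UNIV. w u v * \<phi>0 v) = ?d u * \<phi>0 u - (l0 - V u) * ?q u * \<phi>0 u"
        using eq0[of u] by linarith
      finally show "(\<Sum>v\<in>UNIV. c u v * (g u)\<^sup>2) =
          ?d u * (p u)\<^sup>2 + \<gamma> * (?q u * (p u)\<^sup>2) - (l1 - V u) * ?q u * (p u)\<^sup>2"
        by (simp add: p_g assms(12) power2_eq_square algebra_simps)
    qed
    also have "\<dots> = A + \<gamma> * N - P"
      by (simp add: sum.distrib sum_subtractf A_def N_def P_def sum_distrib_left)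
    finally show ?thesis using P_nn by simp
  qed

  have h_nn: "h \<ge> 0"
    unfolding assms(13) using assms(1,10) w_nn q_pos
    by (intro cheeger_nonneg) (auto simp: less_imp_le)
  have hN_le: "h * N \<le> (\<Sum>u\<in>UNIV. \<Sum>v\<in>UNIV. c u v * \<bar>(g u)\<^sup>2 - (g v)\<^sup>2\<bar>) / 2"
  proof -
    define m where "m u = ?q u * (\<phi>0 u)\<^sup>2" for u
    have half: "vol k w \<phi>0 S \<le> vol k w \<phi>0 (- S)"
      using assms(15) by (simp add: vol_def)
    have "h * (\<Sum>u\<in>UNIV. m u * (g u)\<^sup>2) \<le> (\<Sum>u\<in>UNIV. \<Sum>v\<in>UNIV. c u v * \<bar>(g u)\<^sup>2 - (g v)\<^sup>2\<bar>) / 2"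
    proof (rule coarea_inequality[OF c_sym])
      fix T assume T: "T \<subseteq> S" "T \<noteq> {}"
      have "?q u * (\<phi>0 u)\<^sup>2 > 0" for u using q_pos[of u] \<phi>0_pos[of u] by simp
      from cheeger_mult_vol_le[OF this half T]
      show "h * sum m T \<le> (\<Sum>u\<in>T. \<Sum>v\<in>-T. c u v)"
        by (simp add: assms(13) vol_def m_def boundary_weight_def c_def)
    next
      show "{u. (g u)\<^sup>2 > 0} \<subseteq> S"
      proof
        fix u assume "u \<in> {u. (g u)\<^sup>2 > 0}"
        then have "f u > 0" by (auto simp: g_def max_def split: if_splits)
        then show "u \<in> S" using \<phi>0_pos[of u] by (simp add: assms(14) \<phi>1_f)
      qed
    qed simp
    moreover have "N = (\<Sum>u\<in>UNIV. m u * (g u)\<^sup>2)"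
      by (simp add: N_def m_def p_g power_mult_distrib mult.assoc)
    ultimately show ?thesis by simp
  qed

  have D_nn: "D \<ge> 0" unfolding D_def by (rule dirichlet_nonneg[OF c_nn])
  have \<gamma>_nn: "\<gamma> \<ge> 0" using D_nn D_le N_pos by (metis order_trans zero_le_mult_iff not_le)
  have "(h * N)\<^sup>2 \<le> ((\<Sum>u\<in>UNIV. \<Sum>v\<in>UNIV. c u v * \<bar>(g u)\<^sup>2 - (g v)\<^sup>2\<bar>) / 2)\<^sup>2"
    using hN_le h_nn N_pos by (intro power_mono) auto
  also have "\<dots> \<le> D * (2 * X - D)"
    unfolding D_def X_def by (rule variation_square_le[OF c_sym c_nn])
  also have "\<dots> \<le> D * (2 * (A + \<gamma> * N) - D)"
    using X_le D_nn by (intro mult_left_mono) auto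
  \<comment> \<open>\<open>t (2 M - t) = M\<^sup>2 - (M - t)\<^sup>2\<close> increases on \<open>t \<le> M\<close>, and \<open>D \<le> \<gamma> * N \<le> M\<close> for \<open>M = A + \<gamma> * N\<close>.\<close>
  also have "\<dots> = (A + \<gamma> * N)\<^sup>2 - (A + \<gamma> * N - D)\<^sup>2"
    by (simp add: power2_eq_square algebra_simps)
  also have "\<dots> \<le> (A + \<gamma> * N)\<^sup>2 - A\<^sup>2"
    using D_le A_nn by (intro diff_left_mono power_mono) auto
  finally have "(h * N)\<^sup>2 + A\<^sup>2 \<le> (A + \<gamma> * N)\<^sup>2" by simp
  moreover have "A = Q * N" using N_pos by (simp add: Q_eq)
  ultimately have "(h\<^sup>2 + Q\<^sup>2) * N\<^sup>2 \<le> (\<gamma> + Q)\<^sup>2 * N\<^sup>2"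
    by (simp add: power2_eq_square algebra_simps)
  then have "h\<^sup>2 + Q\<^sup>2 \<le> (\<gamma> + Q)\<^sup>2" using N_pos by simp
  moreover have "\<gamma> + Q \<ge> 0" using \<gamma>_nn A_nn N_pos by (simp add: Q_eq)
  ultimately have "sqrt (h\<^sup>2 + Q\<^sup>2) \<le> \<gamma> + Q" by (intro real_le_lsqrt) auto
  then show ?thesis by simp
qed

end
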